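(* Consider the power system and the PIAC control law described in the context, and let $P_s=\sum_{i\in\mathcal V}P_i$. The controller has the following properties: (a) at any time $t\in T$, $u_s(t)$ satisfies $$\dot u_s(t)=-k\,(P_s+u_s(t)).$$ Thus it is an estimate of the power imbalance $-P_s$; (b) at any time $t\in T$, the input values $\{u_i(t),\,i\in\mathcal V_K\}$ are computed by solving the optimization problem $$\min_{\{u_i\in\mathbb R,\ i\in\mathcal V_K\}}\ \sum_{i\in\mathcal V_K}J_i(u_i)\quad\text{subject to}\quad -u_s(t)+\sum_{i\in\mathcal V_K}u_i(t)=0.$$ So the total amount of control inputs, $u_s(t)$, is dispatched to the local nodes of $\mathcal V_K$ economically; (c) at the steady state (assumed to exist), $\omega_i^*=0$ for all $i\in\mathcal V_M\cup\mathcal V_F$ and the power imbalance $P_s$ is optimally compensated by the local controllers. Hence both of the following problems are solved: (Problem 1) compute inputs $\{u_i,\ i\in\mathcal V_K\}$ that achieve a balance of power supply and demand in terms of $\omega_{syn}=0$, or equivalently $\sum_{i\in\mathcal V}P_i+\sum_{i\in\mathcal V_K}u_i=0$; (Problem 2) compute inputs that, in addition to this balance with $\omega_{syn}=0$, achieve minimal control cost, i.e. that solve $$\min_{\{u_i,\ i\in\mathcal V_K\}}\ \sum_{i\in\mathcal V_K}J_i(u_i)\quad\text{subject to}\quad \sum_{i\in\mathcal V}P_i+\sum_{i\in\mathcal V_K}u_i=0;$$ (d) because $$u_s(t)=-k\sum_{i\in\mathcal V_M}M_i\omega_i(t)-k\int_0^t\sum_{j\in\mathcal V_M\cup\mathcal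 V_F}D_j\omega_j(\tau)\,d\tau,$$ the PIAC control law is of proportional-integral type.
   Context: Power system. $G=(\mathcal V,\mathcal E)$ is an undirected graph whose nodes are buses and whose edges are lossless transmission lines. $\mathcal V=\mathcal V_M\cup\mathcal V_F\cup\mathcal V_P$ consists of three types of nodes: synchronous machines ($\mathcal V_M$), frequency dependent devices ($\mathcal V_F$) and passive loads ($\mathcal V_P$). $B_{ij}$ is the effective susceptance of line $(i,j)$ (the susceptance multiplied by the constant voltages at nodes $i$ and $j$). $M_i>0$ is the moment of inertia of a synchronous machine, $D_i>0$ the droop control coefficient, and $P_i$ the power injection or demand at node $i$. $\mathcal V_K\subseteq\mathcal V_M\cup\mathcal V_F$ is the set of nodes equipped with secondary controllers; $u_i\in[\underline u_i,\overline u_i]$ is the secondary frequency control input, and $u_i=0$ for $i\notin\mathcal V_K$. The system is $$\dot\theta_i=\omega_i,\quad i\in\mathcal V_M\cup\mathcal V_F,$$ $$M_i\dot\omega_i+D_i\omega_i=P_i-\sum_{j\in\mathcal V}B_{ij}\sin(\theta_i-\theta_j)+u_i,\quad i\in\mathcal V_M,$$ $$D_i\omega_i=P_i-\sum_{j\in\mathcal V}B_{ij}\sin(\theta_i-\theta_j)+u_i,\quad i\in\mathcal V_F,$$ $$0=P_i-\sum_{j\in\mathcal V}B_{ij}\sin(\theta_i-\theta_j),\quad i\in\mathcal V_P,$$ where $\theta_i$ is the phase angle at node $i$ and $\omega_i$ is the frequency deviation from the nominal frequency. PIAC (Power-Imbalance Allocation Control) is the dynamic controller $$\dot\eta(t)=\sum_{i\in\mathcal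 V_M\cup\mathcal V_F}D_i\omega_i(t),\qquad u_s(t)=-k\Big(\eta(t)+\sum_{j\in\mathcal V_M}M_j\omega_j(t)\Big),$$ $$0=-u_s(t)+\sum_{i\in\mathcal V_K}(J_i')^{-1}(\lambda(t)),\qquad u_i(t)=(J_i')^{-1}(\lambda(t)),\ i\in\mathcal V_K,$$ where $k\in(0,\infty)$ is a parameter of the control law, $\eta$ is a state variable introduced for the integral term, $\lambda$ is an algebraic variable (a function of time), $J_i$ is the control cost function of node $i$, and $(J_i')^{-1}$ is the inverse function of the derivative $J_i'$, which exists by assumption (2) below. $T$ denotes the time interval considered. Assumptions under which the PIAC control law is defined. (1) During a small time interval the values of power supply and demand are constant, and for these values there exist control inputs $u_i\in[\underline u_i,\overline u_i]$, $i\in\mathcal V_K$, such that $\sum_{i\in\mathcal V}P_i+\sum_{i\in\mathcal V_K}u_i=0$; the costs $J_i$ incorporate the constraints $u_i\in[\underline u_i,\overline u_i]$. (2) The cost functions $J_i:\mathbb R\to\mathbb R$, $i\in\mathcal V_K$, are twice continuously differentiable and strictly convex such that $J_i''(u_i)>0$. (3) All buses in $\mathcal V_M\cup\mathcal V_F$ can communicate with a central coordinator; the frequency deviations $\omega_i$, $i\in\mathcal V_M\cup\mathcal V_F$, can be measured and communicated to the coordinator, and the inputs $u_i$, $i\in\mathcal V_K$, can be computed by the coordinator and dispatched to the controllers at the nodes. Time delays in measurement and communication are neglected. The steady state is a synchronous state: $\theta_i=\omega_{syn}t+\theta_i^*$ and $\dot\theta_i=\omega_{syn}$ for $i\in\mathcal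 V$, and $\omega_i=\omega_{syn}$, $\dot\omega_i=0$ for $i\in\mathcal V_M\cup\mathcal V_F$, where $\omega_{syn}$ is the synchronized frequency deviation; a superscript $*$ denotes values at the steady state. At such a state $\omega_{syn}=\big(\sum_{i\in\mathcal V}P_i+\sum_{i\in\mathcal V_K}u_i\big)/\sum_{i\in\mathcal V_M\cup\mathcal V_F}D_i$. That $u_s$ is an estimate of $-P_s$ means that $u_s(t)$ converges to $-P_s$ exponentially with a speed determined by $k$.
   Formalization: In (d) the initial condition $\eta(0)=0$ is added, which the English does not state: for $\eta(0)\neq 0$ the displayed formula for $u_s(t)$ is off by $-k\eta(0)$ and so false. The time interval $T$ is taken to contain its starting time 0. *)

theory Defs
  imports "HOL-Analysis.Analysis"
begin

record 'v power_system =
  machines :: "'v set"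
  freq_devices :: "'v set"
  passive_loads :: "'v set"
  lines :: "'v set set"
  susceptance :: "'v \<Rightarrow> 'v \<Rightarrow> real"
  inertia :: "'v \<Rightarrow> real"
  droop :: "'v \<Rightarrow> real"
  injection :: "'v \<Rightarrow> real"
  controllers :: "'v set"
  u_min :: "'v \<Rightarrow> real"
  u_max :: "'v \<Rightarrow> real"
  cost :: "'v \<Rightarrow> real \<Rightarrow> real"

definition buses :: "'v power_system \<Rightarrow> 'v set" where
  "buses S = machines S \<union> freq_devices S \<union> passive_loads S"

definition freq_buses :: "'v power_system \<Rightarrow> 'v set" where
  "freq_buses S = machines S \<union> freq_devices S"

text \<open>Non-emptiness of the set of machines and frequency dependent devices is what makes the
  synchronized frequency, a quotient by the total droop coefficient, well defined.\<close>

definition well_formed :: "'v power_system \<Rightarrow> bool" where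
  "well_formed S \<longleftrightarrow>
     finite (buses S) \<and>
     machines S \<inter> freq_devices S = {} \<and>
     machines S \<inter> passive_loads S = {} \<and>
     freq_devices S \<inter> passive_loads S = {} \<and>
     freq_buses S \<noteq> {} \<and>
     (\<forall>e\<in>lines S. e \<subseteq> buses S \<and> card e = 2) \<and>
     (\<forall>i\<in>buses S. \<forall>j\<in>buses S. susceptance S i j = susceptance S j i) \<and>
     (\<forall>i\<in>buses S. \<forall>j\<in>buses S. {i, j} \<notin> lines S \<longrightarrow> susceptance S i j = 0) \<and>
     (\<forall>i\<in>machines S. inertia S i > 0) \<and>
     (\<forall>i\<in>freq_buses S. droop S i > 0) \<and>
     controllers S \<subseteq> freq_buses S"

definition power_imbalance :: "'v power_system \<Rightarrow> real" where
  "power_imbalance S = (\<Sum>i\<in>buses S. injection S i)"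

text \<open>The next predicates on a vector of inputs only depend on its values on the controllers.\<close>

definition balanced :: "'v power_system \<Rightarrow> ('v \<Rightarrow> real) \<Rightarrow> bool" where
  "balanced S v \<longleftrightarrow> (\<Sum>i\<in>buses S. injection S i) + (\<Sum>i\<in>controllers S. v i) = 0"

definition total_cost :: "'v power_system \<Rightarrow> ('v \<Rightarrow> real) \<Rightarrow> real" where
  "total_cost S v = (\<Sum>i\<in>controllers S. cost S i (v i))"

definition sync_frequency :: "'v power_system \<Rightarrow> ('v \<Rightarrow> real) \<Rightarrow> real" where
  "sync_frequency S v =
     ((\<Sum>i\<in>buses S. injection S i) + (\<Sum>i\<in>controllers S. v i)) / (\<Sum>i\<in>freq_buses S. droop S i)"

definition solves_problem1 :: "'v power_system \<Rightarrow> ('v \<Rightarrow> real) \<Rightarrow> bool" where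
  "solves_problem1 S v \<longleftrightarrow> sync_frequency S v = 0"

definition solves_problem2 :: "'v power_system \<Rightarrow> ('v \<Rightarrow> real) \<Rightarrow> bool" where
  "solves_problem2 S v \<longleftrightarrow> sync_frequency S v = 0 \<and> is_arg_min (total_cost S) (balanced S) v"

definition strictly_convex :: "(real \<Rightarrow> real) \<Rightarrow> bool" where
  "strictly_convex f \<longleftrightarrow>
     (\<forall>x y a. x \<noteq> y \<longrightarrow> 0 < a \<longrightarrow> a < 1 \<longrightarrow> f ((1 - a) * x + a * y) < (1 - a) * f x + a * f y)"

definition twice_continuously_differentiable :: "(real \<Rightarrow> real) \<Rightarrow> bool" where
  "twice_continuously_differentiable f \<longleftrightarrow>
     f differentiable_on UNIV \<and> deriv f differentiable_on UNIV \<and> continuous_on UNIV (deriv (deriv f))"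

text \<open>The injections are constants of the system, i.e. supply and demand do not vary over the time
  interval. The input bounds only enter through the existence of an admissible balancing input:
  the control costs are real functions on the whole line that incorporate the bounds.\<close>

definition piac_assumptions :: "'v power_system \<Rightarrow> bool" where
  "piac_assumptions S \<longleftrightarrow>
     (\<exists>v. (\<forall>i\<in>controllers S. v i \<in> {u_min S i..u_max S i}) \<and> balanced S v) \<and>
     (\<forall>i\<in>controllers S. twice_continuously_differentiable (cost S i) \<and> strictly_convex (cost S i) \<and>
        (\<forall>x. deriv (deriv (cost S i)) x > 0))"

definition time_interval :: "real set \<Rightarrow> bool" where
  "time_interval T \<longleftrightarrow> is_interval T \<and> 0 \<in> T \<and> T \<subseteq> {0..} \<and> T \<noteq> {0}"

definition net_injection :: "'v power_system \<Rightarrow> ('v \<Rightarrow> real \<Rightarrow> real) \<Rightarrow> 'v \<Rightarrow> real \<Rightarrow> real" where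
  "net_injection S \<theta> i t =
     injection S i - (\<Sum>j\<in>buses S. susceptance S i j * sin (\<theta> i t - \<theta> j t))"

definition power_system_dynamics ::
  "'v power_system \<Rightarrow> real set \<Rightarrow> ('v \<Rightarrow> real \<Rightarrow> real) \<Rightarrow> ('v \<Rightarrow> real \<Rightarrow> real) \<Rightarrow> ('v \<Rightarrow> real \<Rightarrow> real) \<Rightarrow> bool"
  where
  "power_system_dynamics S T \<theta> \<omega> u \<longleftrightarrow>
     (\<forall>t\<in>T. \<forall>i\<in>freq_buses S. (\<theta> i has_real_derivative \<omega> i t) (at t within T)) \<and>
     (\<forall>t\<in>T. \<forall>i\<in>machines S. \<exists>\<omega>'. (\<omega> i has_real_derivative \<omega>') (at t within T) \<and>
        inertia S i * \<omega>' + droop S i * \<omega> i t = net_injection S \<theta> i t + u i t) \<and>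
     (\<forall>t\<in>T. \<forall>i\<in>freq_devices S. droop S i * \<omega> i t = net_injection S \<theta> i t + u i t) \<and>
     (\<forall>t\<in>T. \<forall>i\<in>passive_loads S. 0 = net_injection S \<theta> i t) \<and>
     (\<forall>t\<in>T. \<forall>i\<in>buses S - controllers S. u i t = 0)"

text \<open>The derivative of a cost function is injective but need not be onto, so its inverse is only
  defined on its range; the control law requires the argument to lie in that range. No initial
  value of the integral state is prescribed here.\<close>

definition piac_control_law ::
  "'v power_system \<Rightarrow> real \<Rightarrow> real set \<Rightarrow> ('v \<Rightarrow> real \<Rightarrow> real) \<Rightarrow> ('v \<Rightarrow> real \<Rightarrow> real) \<Rightarrow>
     (real \<Rightarrow> real) \<Rightarrow> (real \<Rightarrow> real) \<Rightarrow> (real \<Rightarrow> real) \<Rightarrow> bool" where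
  "piac_control_law S k T \<omega> u \<eta> us l \<longleftrightarrow>
     (\<forall>t\<in>T. (\<eta> has_real_derivative (\<Sum>i\<in>freq_buses S. droop S i * \<omega> i t)) (at t within T)) \<and>
     (\<forall>t\<in>T. us t = - k * (\<eta> t + (\<Sum>j\<in>machines S. inertia S j * \<omega> j t))) \<and>
     (\<forall>t\<in>T. \<forall>i\<in>controllers S. l t \<in> range (deriv (cost S i))) \<and>
     (\<forall>t\<in>T. 0 = - us t + (\<Sum>i\<in>controllers S. inv (deriv (cost S i)) (l t))) \<and>
     (\<forall>t\<in>T. \<forall>i\<in>controllers S. u i t = inv (deriv (cost S i)) (l t))"

definition synchronous_state ::
  "'v power_system \<Rightarrow> real set \<Rightarrow> ('v \<Rightarrow> real \<Rightarrow> real) \<Rightarrow> ('v \<Rightarrow> real \<Rightarrow> real) \<Rightarrow> real \<Rightarrow> ('v \<Rightarrow> real) \<Rightarrow> bool"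
  where
  "synchronous_state S T \<theta> \<omega> \<omega>syn \<theta>star \<longleftrightarrow>
     (\<forall>t\<in>T. \<forall>i\<in>buses S. \<theta> i t = \<omega>syn * t + \<theta>star i \<and>
        (\<theta> i has_real_derivative \<omega>syn) (at t within T)) \<and>
     (\<forall>t\<in>T. \<forall>i\<in>freq_buses S. \<omega> i t = \<omega>syn \<and> (\<omega> i has_real_derivative 0) (at t within T))"

definition converges_exponentially :: "real set \<Rightarrow> real \<Rightarrow> (real \<Rightarrow> real) \<Rightarrow> real \<Rightarrow> bool" where
  "converges_exponentially T k f L \<longleftrightarrow>
     (\<forall>t\<in>T. \<bar>f t - L\<bar> \<le> \<bar>f 0 - L\<bar> * exp (- k * t)) \<and>
     (\<not> bdd_above T \<longrightarrow> (f \<longlongrightarrow> L) at_top)"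

text \<open>Control of proportional-integral type in the measured signals \<^term>\<open>y\<close>, with constant
  proportional gains \<^term>\<open>kp\<close> and integral gains \<^term>\<open>ki\<close>.\<close>

definition proportional_integral ::
  "real set \<Rightarrow> 'v set \<Rightarrow> ('v \<Rightarrow> real) \<Rightarrow> ('v \<Rightarrow> real) \<Rightarrow> ('v \<Rightarrow> real \<Rightarrow> real) \<Rightarrow> (real \<Rightarrow> real) \<Rightarrow> bool" where
  "proportional_integral T I kp ki y f \<longleftrightarrow>
     (\<forall>t\<in>T. (\<lambda>\<tau>. \<Sum>i\<in>I. ki i * y i \<tau>) integrable_on {0..t} \<and>
        f t = (\<Sum>i\<in>I. kp i * y i t) + integral {0..t} (\<lambda>\<tau>. \<Sum>i\<in>I. ki i * y i \<tau>))"

end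

theory Submission
  imports Defs
begin

text \<open>
  The physical core is the conservation law obtained by adding up the bus equations: line flows are
  antisymmetric, so they cancel, and \<open>\<Sum> M\<^sub>i \<omega>\<^sub>i' + \<Sum> D\<^sub>i \<omega>\<^sub>i = P\<^sub>s + u\<^sub>s\<close>
  (\<open>aggregate_power_balance\<close>). Up to the factor \<open>-k\<close> the left-hand side is exactly the derivative of
  the control signal \<open>u\<^sub>s\<close>, whose integral term supplies the droop sum and whose proportional
  term supplies the inertia sum. Hence \<open>u\<^sub>s\<close> obeys the scalar linear equation
  \<open>u\<^sub>s' = -k (P\<^sub>s + u\<^sub>s)\<close>, whose solutions approach \<open>-P\<^sub>s\<close> at rate \<open>k\<close>
  whatever the angles do.

  The economic part is Lagrangian duality. All controllers use the same marginal cost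
  \<open>J\<^sub>i'(u\<^sub>i) = \<lambda>\<close>, so the strict tangent inequality for each \<open>J\<^sub>i\<close>, summed over a
  competitor with the same total, makes the terms in \<open>\<lambda>\<close> cancel. What remains says that the dispatch
  is the only minimiser (\<open>equal_marginal_costs_unique_minimiser\<close>).

  In a synchronous state the conservation law forces \<open>u\<^sub>s\<close> to be constant; the linear equation
  then gives \<open>u\<^sub>s = -P\<^sub>s\<close> and, by the conservation law again, \<open>\<omega>\<^sub>s\<^sub>y\<^sub>n = 0\<close>. As the dispatch
  is determined by \<open>u\<^sub>s\<close> through uniqueness of the minimiser, the individual inputs are constant
  too, and their constraint set is precisely the set of balancing inputs. The
  proportional-integral form is the fundamental theorem of calculus for \<open>\<eta>\<close>.
\<close>

section \<open>Intervals of time and linear relaxation\<close>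

lemma time_interval_segment:
  assumes "time_interval T" "t \<in> T"
  shows "0 \<le> t" "{0..t} \<subseteq> T"
  using assms unfolding time_interval_def is_interval_1 by auto

text \<open>A time interval has no isolated points, so one-sided derivatives at its end points are still
  unique.\<close>

lemma time_interval_at_within_nontrivial:
  assumes "time_interval T" "t \<in> T"
  shows "at t within T \<noteq> bot"
proof -
  have "connected T" "0 \<in> T" "T \<noteq> {0}"
    using assms unfolding time_interval_def by (auto simp: is_interval_connected)
  moreover have "T \<noteq> {t}"
    using \<open>0 \<in> T\<close> \<open>T \<noteq> {0}\<close> by auto
  ultimately show ?thesis
    using assms(2) connected_imp_perfect by (auto simp: trivial_limit_within)
qed

text \<open>The factor \<open>exp (k t)\<close> turns the equation into a vanishing derivative.\<close>

lemma linear_relaxation_solution: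
  fixes f :: "real \<Rightarrow> real"
  assumes "convex T" "0 \<in> T" "t \<in> T"
    and deriv: "\<And>s. s \<in> T \<Longrightarrow> (f has_real_derivative - k * (f s - L)) (at s within T)"
  shows "f t - L = (f 0 - L) * exp (- k * t)"
proof -
  have "((\<lambda>s. (f s - L) * exp (k * s)) has_real_derivative 0) (at s within T)" if "s \<in> T" for s
    using deriv[OF that] by (auto intro!: derivative_eq_intros simp: algebra_simps)
  from has_field_derivative_zero_constant[OF assms(1) this]
  obtain c where c: "\<And>s. s \<in> T \<Longrightarrow> (f s - L) * exp (k * s) = c"
    by auto
  have "(f t - L) * exp (k * t) = f 0 - L"
    using c[OF assms(2)] c[OF assms(3)] by simp
  then have "(f 0 - L) * exp (- k * t) = (f t - L) * (exp (k * t) * exp (- k * t))"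
    by (metis mult.assoc)
  also have "\<dots> = f t - L"
    by (simp flip: exp_add)
  finally show ?thesis by simp
qed

lemma linear_relaxation_converges_exponentially:
  assumes "time_interval T" "k > 0"
    and "\<And>s. s \<in> T \<Longrightarrow> (f has_real_derivative - k * (f s - L)) (at s within T)"
  shows "converges_exponentially T k f L"
proof -
  have "convex T" "0 \<in> T"
    using assms(1) unfolding time_interval_def by (auto simp: is_interval_convex)
  then have sol: "f t - L = (f 0 - L) * exp (- k * t)" if "t \<in> T" for t
    using linear_relaxation_solution assms(3) that by blast
  have "(f \<longlongrightarrow> L) at_top" if "\<not> bdd_above T"
  proof -
    have "t \<in> T" if "t \<ge> 0" for t
    proof -
      obtain s where "s \<in> T" "s > t"
        using \<open>\<not> bdd_above T\<close> unfolding bdd_above_def by (meson not_le)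
      then show ?thesis
        using time_interval_segment[OF assms(1)] \<open>t \<ge> 0\<close> by (meson atLeastAtMost_iff less_imp_le subsetD)
    qed
    then have "eventually (\<lambda>t. L + (f 0 - L) * exp (- k * t) = f t) at_top"
      using sol by (intro eventually_at_top_linorderI[of 0]) (smt (verit))
    moreover have "((\<lambda>t. exp (- k * t)) \<longlongrightarrow> 0) at_top"
    proof (rule filterlim_compose[OF exp_at_bot])
      show "filterlim (\<lambda>t. - k * t) at_bot at_top"
        using assms(2) by (intro filterlim_tendsto_neg_mult_at_bot[OF tendsto_const])
          (auto simp: filterlim_ident)
    qed
    then have "((\<lambda>t. L + (f 0 - L) * exp (- k * t)) \<longlongrightarrow> L + (f 0 - L) * 0) at_top"
      by (intro tendsto_intros)
    ultimately show ?thesis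
      using Lim_transform_eventually by fastforce
  qed
  then show ?thesis
    unfolding converges_exponentially_def by (simp add: sol abs_mult)
qed

section \<open>Economic dispatch\<close>

text \<open>Positivity of the second derivative makes the slope increase strictly, so the mean value
  theorem puts the graph strictly above its tangent on both sides of the point of contact.\<close>

lemma strict_tangent_inequality:
  fixes f :: "real \<Rightarrow> real"
  assumes "twice_continuously_differentiable f" "\<And>x. deriv (deriv f) x > 0" "x \<noteq> y"
  shows "f y > f x + deriv f x * (y - x)"
proof -
  have d1: "(f has_real_derivative deriv f z) (at z)"
    and d2: "(deriv f has_real_derivative deriv (deriv f) z) (at z)" for z
    using assms(1) unfolding twice_continuously_differentiable_def differentiable_on_def
    by (auto simp: DERIV_deriv_iff_real_differentiable)
  have mono: "deriv f a < deriv f b" if "a < b" for a b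
    using DERIV_pos_imp_increasing[OF that] d2 assms(2) by blast
  show ?thesis
  proof (cases "x < y")
    case True
    then obtain z where "x < z" "f y - f x = (y - x) * deriv f z"
      using MVT2[OF True d1] by blast
    then show ?thesis
      using mono[of x z] mult_strict_left_mono[of "deriv f x" "deriv f z" "y - x"] True
      by (simp add: algebra_simps)
  next
    case False
    with assms(3) have "y < x" by simp
    then obtain z where "z < x" "f x - f y = (x - y) * deriv f z"
      using MVT2[OF _ d1] by blast
    then show ?thesis
      using mono[of z x] mult_strict_left_mono[of "deriv f z" "deriv f x" "x - y"] \<open>y < x\<close>
      by (simp add: algebra_simps)
  qed
qed

text \<open>Sufficiency of the first-order condition: the common marginal cost \<open>m\<close> is a Lagrange
  multiplier for the constraint on the sum, and strict convexity makes the minimiser unique.\<close>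

lemma equal_marginal_costs_unique_minimiser:
  fixes J :: "'i \<Rightarrow> real \<Rightarrow> real"
  assumes "finite K"
    and smooth: "\<And>i. i \<in> K \<Longrightarrow> twice_continuously_differentiable (J i)"
    and pos: "\<And>i x. i \<in> K \<Longrightarrow> deriv (deriv (J i)) x > 0"
    and marginal: "\<And>i. i \<in> K \<Longrightarrow> deriv (J i) (w i) = m"
    and total: "(\<Sum>i\<in>K. w i) = c"
  shows "is_arg_min (\<lambda>v. \<Sum>i\<in>K. J i (v i)) (\<lambda>v. - c + (\<Sum>i\<in>K. v i) = 0) v
           \<longleftrightarrow> (\<forall>i\<in>K. v i = w i)"
proof -
  have le: "J i (w i) + m * (v i - w i) \<le> J i (v i)" if "i \<in> K" for i v
    using strict_tangent_inequality[OF smooth pos, OF that that, of "w i" "v i"] marginal[OF that]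
    by (cases "w i = v i") auto
  have feasible_sum: "(\<Sum>i\<in>K. J i (w i) + m * (v i - w i)) = (\<Sum>i\<in>K. J i (w i))"
    if "(\<Sum>i\<in>K. v i) = c" for v
    using that total by (simp add: sum.distrib sum_subtractf flip: sum_distrib_left)
  have minimal: "(\<Sum>i\<in>K. J i (w i)) \<le> (\<Sum>i\<in>K. J i (v i))" if "(\<Sum>i\<in>K. v i) = c" for v
    unfolding feasible_sum[OF that, symmetric] by (intro sum_mono le)
  have strict: "(\<Sum>i\<in>K. J i (w i)) < (\<Sum>i\<in>K. J i (v i))"
    if "(\<Sum>i\<in>K. v i) = c" "j \<in> K" "v j \<noteq> w j" for v j
  proof -
    have "J j (w j) + m * (v j - w j) < J j (v j)"
      using strict_tangent_inequality[OF smooth pos, OF that(2) that(2), of "w j" "v j"]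
        marginal[OF that(2)] that(3) by auto
    then have "(\<Sum>i\<in>K. J i (w i) + m * (v i - w i)) < (\<Sum>i\<in>K. J i (v i))"
      using le that(2) by (intro sum_strict_mono_ex1[OF assms(1)]) auto
    then show ?thesis
      using feasible_sum[OF that(1)] by simp
  qed
  show ?thesis
  proof
    assume "is_arg_min (\<lambda>v. \<Sum>i\<in>K. J i (v i)) (\<lambda>v. - c + (\<Sum>i\<in>K. v i) = 0) v"
    then have "(\<Sum>i\<in>K. v i) = c" "\<not> (\<Sum>i\<in>K. J i (w i)) < (\<Sum>i\<in>K. J i (v i))"
      using total unfolding is_arg_min_def by auto
    then show "\<forall>i\<in>K. v i = w i"
      using strict by blast
  next
    assume eq: "\<forall>i\<in>K. v i = w i"
    then have "(\<Sum>i\<in>K. v i) = c" "(\<Sum>i\<in>K. J i (v i)) = (\<Sum>i\<in>K. J i (w i))"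
      using total by (auto cong: sum.cong)
    then show "is_arg_min (\<lambda>v. \<Sum>i\<in>K. J i (v i)) (\<lambda>v. - c + (\<Sum>i\<in>K. v i) = 0) v"
      unfolding is_arg_min_def using minimal by (auto simp: not_less)
  qed
qed

lemma piac_total_input:
  assumes "piac_control_law S k T \<omega> u \<eta> us l" "t \<in> T"
  shows "(\<Sum>i\<in>controllers S. u i t) = us t"
proof -
  have "(\<Sum>i\<in>controllers S. u i t) = (\<Sum>i\<in>controllers S. inv (deriv (cost S i)) (l t))"
    using assms unfolding piac_control_law_def by (intro sum.cong) auto
  then show ?thesis
    using assms unfolding piac_control_law_def by auto
qed

lemma piac_unique_optimal_dispatch:
  assumes "finite (controllers S)" "piac_assumptions S"
    and "piac_control_law S k T \<omega> u \<eta> us l" "t \<in> T"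
  shows "is_arg_min (total_cost S) (\<lambda>w. - us t + (\<Sum>i\<in>controllers S. w i) = 0) v
           \<longleftrightarrow> (\<forall>i\<in>controllers S. v i = u i t)"
proof -
  have "deriv (cost S i) (u i t) = l t" if "i \<in> controllers S" for i
  proof -
    have "u i t = inv (deriv (cost S i)) (l t)" "l t \<in> range (deriv (cost S i))"
      using assms(3,4) that unfolding piac_control_law_def by blast+
    then show ?thesis
      by (simp add: f_inv_into_f)
  qed
  then show ?thesis
    unfolding total_cost_def[abs_def]
    using assms(1,2) piac_total_input[OF assms(3,4)]
    by (intro equal_marginal_costs_unique_minimiser[where m = "l t"])
      (auto simp: piac_assumptions_def)
qed

section \<open>Conservation of power\<close>

lemma sum_antisymmetric_eq_0:
  fixes g :: "'a \<Rightarrow> 'a \<Rightarrow> real"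
  assumes "\<And>i j. i \<in> A \<Longrightarrow> j \<in> A \<Longrightarrow> g i j = - g j i"
  shows "(\<Sum>i\<in>A. \<Sum>j\<in>A. g i j) = 0"
proof -
  have "(\<Sum>i\<in>A. \<Sum>j\<in>A. g i j) = (\<Sum>i\<in>A. \<Sum>j\<in>A. - g j i)"
    by (intro sum.cong refl assms)
  also have "\<dots> = - (\<Sum>i\<in>A. \<Sum>j\<in>A. g i j)"
    by (subst sum.swap) (simp add: sum_negf)
  finally show ?thesis by simp
qed

text \<open>The lines are lossless: what flows out of one end of a line flows into the other.\<close>

lemma sum_net_injection:
  assumes "well_formed S"
  shows "(\<Sum>i\<in>buses S. net_injection S \<theta> i t) = power_imbalance S"
proof -
  have "(\<Sum>i\<in>buses S. \<Sum>j\<in>buses S. susceptance S i j * sin (\<theta> i t - \<theta> j t)) = 0"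
  proof (rule sum_antisymmetric_eq_0)
    fix i j assume "i \<in> buses S" "j \<in> buses S"
    then have "susceptance S i j = susceptance S j i"
      using assms unfolding well_formed_def by blast
    then show "susceptance S i j * sin (\<theta> i t - \<theta> j t) = - (susceptance S j i * sin (\<theta> j t - \<theta> i t))"
      using sin_minus[of "\<theta> j t - \<theta> i t"] by simp
  qed
  then show ?thesis
    unfolding net_injection_def power_imbalance_def by (simp add: sum_subtractf)
qed

text \<open>Adding up all bus equations eliminates the angles. The derivatives of the machine frequencies
  are arguments here, since the dynamics only asserts that they exist.\<close>

lemma aggregate_power_balance:
  assumes wf: "well_formed S" and dyn: "power_system_dynamics S T \<theta> \<omega> u" and t: "t \<in> T"
    and machine: "\<And>i. i \<in> machines S \<Longrightarrow>
           inertia S i * a i + droop S i * \<omega> i t = net_injection S \<theta> i t + u i t"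
  shows "(\<Sum>i\<in>machines S. inertia S i * a i) + (\<Sum>i\<in>freq_buses S. droop S i * \<omega> i t)
           = power_imbalance S + (\<Sum>i\<in>controllers S. u i t)"
proof -
  have fin: "finite (machines S)" "finite (freq_devices S)" "finite (passive_loads S)"
    "finite (buses S)"
    and disj: "machines S \<inter> freq_devices S = {}"
      "(machines S \<union> freq_devices S) \<inter> passive_loads S = {}"
    and sub: "controllers S \<subseteq> buses S" "controllers S \<inter> passive_loads S = {}"
    using wf unfolding well_formed_def buses_def freq_buses_def by auto
  have buses_split: "sum g (buses S) = sum g (machines S) + sum g (freq_devices S) + sum g (passive_loads S)"
    for g :: "'a \<Rightarrow> real"
    unfolding buses_def using fin disj by (simp add: sum.union_disjoint)
  have load: "net_injection S \<theta> i t + u i t = 0" if i: "i \<in> passive_loads S" for i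
  proof -
    have "i \<in> buses S - controllers S"
      using i sub unfolding buses_def by blast
    then have "u i t = 0" "0 = net_injection S \<theta> i t"
      using dyn t i unfolding power_system_dynamics_def by blast+
    then show ?thesis by simp
  qed
  have device: "droop S i * \<omega> i t = net_injection S \<theta> i t + u i t" if "i \<in> freq_devices S" for i
    using dyn t that unfolding power_system_dynamics_def by blast
  have "(\<Sum>i\<in>machines S. inertia S i * a i) + (\<Sum>i\<in>freq_buses S. droop S i * \<omega> i t)
      = (\<Sum>i\<in>machines S. inertia S i * a i + droop S i * \<omega> i t)
        + (\<Sum>i\<in>freq_devices S. droop S i * \<omega> i t)"
    unfolding freq_buses_def using fin disj by (simp add: sum.union_disjoint sum.distrib)
  also have "\<dots> = (\<Sum>i\<in>machines S. net_injection S \<theta> i t + u i t)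
        + (\<Sum>i\<in>freq_devices S. net_injection S \<theta> i t + u i t)"
    using machine device by simp
  also have "\<dots> = (\<Sum>i\<in>buses S. net_injection S \<theta> i t + u i t)"
    using load by (simp add: buses_split)
  also have "\<dots> = power_imbalance S + (\<Sum>i\<in>buses S. u i t)"
    by (simp add: sum.distrib sum_net_injection[OF wf])
  also have "(\<Sum>i\<in>buses S. u i t) = (\<Sum>i\<in>controllers S. u i t)"
  proof (rule sum.mono_neutral_right[OF fin(4) sub(1)])
    show "\<forall>i\<in>buses S - controllers S. u i t = 0"
      using dyn t unfolding power_system_dynamics_def by blast
  qed
  finally show ?thesis .
qed

lemma total_droop_pos:
  assumes "well_formed S"
  shows "(\<Sum>i\<in>freq_buses S. droop S i) > 0"
  using assms unfolding well_formed_def buses_def freq_buses_def by (intro sum_pos) auto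

lemma sync_frequency_eq_0_iff_balanced:
  assumes "well_formed S"
  shows "sync_frequency S v = 0 \<longleftrightarrow> balanced S v"
  using total_droop_pos[OF assms] unfolding sync_frequency_def balanced_def by simp

section \<open>Closed-loop behaviour\<close>

lemma piac_control_signal_derivative:
  assumes wf: "well_formed S" and dyn: "power_system_dynamics S T \<theta> \<omega> u"
    and law: "piac_control_law S k T \<omega> u \<eta> us l" and t: "t \<in> T"
  shows "(us has_real_derivative - k * (power_imbalance S + us t)) (at t within T)"
proof -
  have "\<forall>i\<in>machines S. \<exists>\<omega>'. (\<omega> i has_real_derivative \<omega>') (at t within T) \<and>
      inertia S i * \<omega>' + droop S i * \<omega> i t = net_injection S \<theta> i t + u i t"
    using dyn t unfolding power_system_dynamics_def by blast
  then obtain a where a: "\<And>i. i \<in> machines S \<Longrightarrow> (\<omega> i has_real_derivative a i) (at t within T)"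
    "\<And>i. i \<in> machines S \<Longrightarrow>
      inertia S i * a i + droop S i * \<omega> i t = net_injection S \<theta> i t + u i t"
    by metis
  have "(\<eta> has_real_derivative (\<Sum>i\<in>freq_buses S. droop S i * \<omega> i t)) (at t within T)"
    using law t unfolding piac_control_law_def by blast
  moreover have "((\<lambda>s. \<Sum>i\<in>machines S. inertia S i * \<omega> i s) has_real_derivative
      (\<Sum>i\<in>machines S. inertia S i * a i)) (at t within T)"
    using a(1) by (intro DERIV_sum DERIV_cmult)
  ultimately have "((\<lambda>s. - k * (\<eta> s + (\<Sum>i\<in>machines S. inertia S i * \<omega> i s))) has_real_derivative
      - k * ((\<Sum>i\<in>freq_buses S. droop S i * \<omega> i t) + (\<Sum>i\<in>machines S. inertia S i * a i)))
      (at t within T)"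
    by (intro DERIV_cmult DERIV_add)
  then have signal: "((\<lambda>s. - k * (\<eta> s + (\<Sum>i\<in>machines S. inertia S i * \<omega> i s)))
      has_real_derivative - k * (power_imbalance S + us t)) (at t within T)"
    using aggregate_power_balance[OF wf dyn t a(2)] piac_total_input[OF law t]
    by (simp add: add.commute)
  show ?thesis
  proof (rule has_field_derivative_transform_within[OF signal zero_less_one t])
    show "- k * (\<eta> s + (\<Sum>i\<in>machines S. inertia S i * \<omega> i s)) = us s" if "s \<in> T" for s
      using law that unfolding piac_control_law_def by presburger
  qed
qed

lemma synchronous_state_frequency_balance:
  assumes wf: "well_formed S" and T: "time_interval T"
    and dyn: "power_system_dynamics S T \<theta> \<omega> u"
    and sync: "synchronous_state S T \<theta> \<omega> \<omega>syn \<theta>star" and t: "t \<in> T"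
  shows "\<omega>syn * (\<Sum>i\<in>freq_buses S. droop S i)
           = power_imbalance S + (\<Sum>i\<in>controllers S. u i t)"
proof -
  have \<omega>: "\<omega> i t = \<omega>syn" "(\<omega> i has_real_derivative 0) (at t within T)" if "i \<in> freq_buses S" for i
    using sync t that unfolding synchronous_state_def by auto
  have "inertia S i * 0 + droop S i * \<omega> i t = net_injection S \<theta> i t + u i t"
    if i: "i \<in> machines S" for i
  proof -
    obtain \<omega>' where "(\<omega> i has_real_derivative \<omega>') (at t within T)"
      and *: "inertia S i * \<omega>' + droop S i * \<omega> i t = net_injection S \<theta> i t + u i t"
      using dyn t i unfolding power_system_dynamics_def by blast
    then have "\<omega>' = 0"
      using \<omega>(2)[of i] i time_interval_at_within_nontrivial[OF T t]
      by (auto simp: freq_buses_def intro: has_field_derivative_unique)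
    with * show ?thesis by simp
  qed
  from aggregate_power_balance[OF wf dyn t this]
  have "(\<Sum>i\<in>freq_buses S. droop S i * \<omega> i t)
      = power_imbalance S + (\<Sum>i\<in>controllers S. u i t)"
    by simp
  then show ?thesis
    using \<omega>(1) by (simp add: mult.commute sum_distrib_left cong: sum.cong)
qed

text \<open>By the power balance of a synchronous state, the control signal is constant there; the only
  constant solution of its linear equation is the negative imbalance.\<close>

lemma synchronous_state_control_signal:
  assumes wf: "well_formed S" and "k > 0" and T: "time_interval T"
    and dyn: "power_system_dynamics S T \<theta> \<omega> u"
    and law: "piac_control_law S k T \<omega> u \<eta> us l"
    and sync: "synchronous_state S T \<theta> \<omega> \<omega>syn \<theta>star" and t: "t \<in> T"
  shows "us t = - power_imbalance S"
proof -
  have "us s = \<omega>syn * (\<Sum>i\<in>freq_buses S. droop S i) - power_imbalance S" if "s \<in> T" for s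
    using synchronous_state_frequency_balance[OF wf T dyn sync that] piac_total_input[OF law that]
    by simp
  then have "(us has_real_derivative 0) (at t within T)"
    by (intro has_field_derivative_transform_within[OF DERIV_const zero_less_one t]) auto
  then have "- k * (power_imbalance S + us t) = 0"
    using has_field_derivative_unique piac_control_signal_derivative[OF wf dyn law t]
      time_interval_at_within_nontrivial[OF T t] by blast
  with \<open>k > 0\<close> show ?thesis by simp
qed

lemma synchronous_state_optimal:
  assumes wf: "well_formed S" and asm: "piac_assumptions S" and k: "k > 0"
    and T: "time_interval T"
    and dyn: "power_system_dynamics S T \<theta> \<omega> u"
    and law: "piac_control_law S k T \<omega> u \<eta> us l"
    and sync: "synchronous_state S T \<theta> \<omega> \<omega>syn \<theta>star"
  shows "(\<forall>t\<in>T. \<forall>i\<in>freq_buses S. \<omega> i t = 0) \<and>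
    (\<exists>ustar. (\<forall>t\<in>T. \<forall>i\<in>controllers S. u i t = ustar i) \<and>
       \<omega>syn = sync_frequency S ustar \<and> solves_problem1 S ustar \<and> solves_problem2 S ustar)"
proof -
  define ustar where "ustar = (\<lambda>i. u i 0)"
  have 0: "0 \<in> T"
    using T unfolding time_interval_def by blast
  have fin: "finite (controllers S)"
    using wf unfolding well_formed_def buses_def freq_buses_def by (meson finite_Un finite_subset)
  note us = synchronous_state_control_signal[OF wf k T dyn law sync]
  note dispatch = piac_unique_optimal_dispatch[OF fin asm law]
  have \<omega>syn: "\<omega>syn = 0"
    using synchronous_state_frequency_balance[OF wf T dyn sync 0] piac_total_input[OF law 0] us[OF 0]
      total_droop_pos[OF wf] by simp
  \<comment> \<open>The problems solved at two instants coincide, hence so do their unique minimisers.\<close>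
  have const: "\<forall>i\<in>controllers S. u i t = ustar i" if t: "t \<in> T" for t
    using dispatch[OF t, of ustar] dispatch[OF 0, of ustar] us[OF t] us[OF 0]
    by (simp add: ustar_def)
  have feasible: "(\<lambda>w. - us 0 + (\<Sum>i\<in>controllers S. w i) = 0) = balanced S"
    unfolding balanced_def us[OF 0] power_imbalance_def by simp
  have opt: "is_arg_min (total_cost S) (balanced S) ustar"
    using dispatch[OF 0, of ustar] unfolding feasible by (simp add: ustar_def)
  then have freq: "sync_frequency S ustar = 0"
    using sync_frequency_eq_0_iff_balanced[OF wf] unfolding is_arg_min_def by blast
  have "\<forall>t\<in>T. \<forall>i\<in>freq_buses S. \<omega> i t = 0"
    using sync \<omega>syn unfolding synchronous_state_def by blast
  then show ?thesis
    using const opt freq \<omega>syn unfolding solves_problem1_def solves_problem2_def by metis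
qed

lemma piac_integral_state:
  assumes "time_interval T" "piac_control_law S k T \<omega> u \<eta> us l" "t \<in> T"
  shows "((\<lambda>\<tau>. \<Sum>i\<in>freq_buses S. droop S i * \<omega> i \<tau>) has_integral (\<eta> t - \<eta> 0)) {0..t}"
proof (rule fundamental_theorem_of_calculus)
  note seg = time_interval_segment[OF assms(1,3)]
  show "0 \<le> t" by (fact seg(1))
  show "(\<eta> has_vector_derivative (\<Sum>i\<in>freq_buses S. droop S i * \<omega> i \<tau>)) (at \<tau> within {0..t})"
    if "\<tau> \<in> {0..t}" for \<tau>
    using assms(2) seg(2) that unfolding piac_control_law_def has_real_derivative_iff_has_vector_derivative
    by (meson has_vector_derivative_within_subset subsetD)
qed

lemma piac_proportional_integral:
  assumes wf: "well_formed S" and T: "time_interval T"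
    and law: "piac_control_law S k T \<omega> u \<eta> us l" and "\<eta> 0 = 0"
  shows "(\<forall>t\<in>T. us t = - k * (\<Sum>i\<in>machines S. inertia S i * \<omega> i t)
           - k * integral {0..t} (\<lambda>\<tau>. \<Sum>j\<in>freq_buses S. droop S j * \<omega> j \<tau>)) \<and>
        proportional_integral T (freq_buses S)
          (\<lambda>i. if i \<in> machines S then - k * inertia S i else 0) (\<lambda>i. - k * droop S i) \<omega> us"
proof -
  have fin: "finite (freq_buses S)" and sub: "machines S \<subseteq> freq_buses S"
    using wf unfolding well_formed_def buses_def freq_buses_def by auto
  have us: "us t = - k * (\<Sum>i\<in>machines S. inertia S i * \<omega> i t) - k * \<eta> t" if "t \<in> T" for t
  proof -
    have "us t = - k * (\<eta> t + (\<Sum>i\<in>machines S. inertia S i * \<omega> i t))"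
      using law that unfolding piac_control_law_def by blast
    then show ?thesis
      by (simp add: algebra_simps)
  qed
  have int: "((\<lambda>\<tau>. \<Sum>i\<in>freq_buses S. droop S i * \<omega> i \<tau>) has_integral \<eta> t) {0..t}"
    if "t \<in> T" for t
    using piac_integral_state[OF T law that] \<open>\<eta> 0 = 0\<close> by simp
  have gain: "(\<Sum>i\<in>freq_buses S. - k * droop S i * \<omega> i \<tau>)
      = - k * (\<Sum>i\<in>freq_buses S. droop S i * \<omega> i \<tau>)" for \<tau>
    by (simp add: sum_distrib_left mult.assoc sum_negf)
  have gain_int: "((\<lambda>\<tau>. \<Sum>i\<in>freq_buses S. - k * droop S i * \<omega> i \<tau>) has_integral - k * \<eta> t) {0..t}"
    if "t \<in> T" for t
    unfolding gain using int[OF that] by (rule has_integral_mult_right)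
  have proportional: "(\<Sum>i\<in>freq_buses S. (if i \<in> machines S then - k * inertia S i else 0) * \<omega> i t)
      = - k * (\<Sum>i\<in>machines S. inertia S i * \<omega> i t)" for t
  proof -
    have "(\<Sum>i\<in>freq_buses S. (if i \<in> machines S then - k * inertia S i else 0) * \<omega> i t)
        = (\<Sum>i\<in>machines S. - k * inertia S i * \<omega> i t)"
      using fin sub by (intro sum.mono_neutral_cong_right) auto
    then show ?thesis
      by (simp add: sum_distrib_left mult.assoc sum_negf)
  qed
  show ?thesis
    unfolding proportional_integral_def proportional
    using us integral_unique[OF int] integral_unique[OF gain_int] has_integral_integrable[OF gain_int]
    by auto
qed

theorem theorem1:
  fixes S :: "'v power_system" and k :: real and T :: "real set"
    and \<theta> \<omega> u :: "'v \<Rightarrow> real \<Rightarrow> real" and \<eta> us l :: "real \<Rightarrow> real"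
  assumes "well_formed S"
    and "piac_assumptions S"
    and "k > 0"
    and "time_interval T"
    and "power_system_dynamics S T \<theta> \<omega> u"
    and "piac_control_law S k T \<omega> u \<eta> us l"
  shows
    "((\<forall>t\<in>T. (us has_real_derivative - k * (power_imbalance S + us t)) (at t within T)) \<and>
      converges_exponentially T k us (- power_imbalance S)) \<and>
     (\<forall>t\<in>T. \<forall>v. is_arg_min (total_cost S) (\<lambda>w. - us t + (\<Sum>i\<in>controllers S. w i) = 0) v \<longleftrightarrow>
        (\<forall>i\<in>controllers S. v i = u i t)) \<and>
     ((\<forall>v. sync_frequency S v = 0 \<longleftrightarrow> balanced S v) \<and>
      (\<forall>\<omega>syn \<theta>star. synchronous_state S T \<theta> \<omega> \<omega>syn \<theta>star \<longrightarrow>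
        (\<forall>t\<in>T. \<forall>i\<in>freq_buses S. \<omega> i t = 0) \<and>
        (\<exists>ustar. (\<forall>t\<in>T. \<forall>i\<in>controllers S. u i t = ustar i) \<and>
           \<omega>syn = sync_frequency S ustar \<and>
           solves_problem1 S ustar \<and> solves_problem2 S ustar))) \<and>
     (\<eta> 0 = 0 \<longrightarrow>
        (\<forall>t\<in>T. us t = - k * (\<Sum>i\<in>machines S. inertia S i * \<omega> i t)
           - k * integral {0..t} (\<lambda>\<tau>. \<Sum>j\<in>freq_buses S. droop S j * \<omega> j \<tau>)) \<and>
        proportional_integral T (freq_buses S)
          (\<lambda>i. if i \<in> machines S then - k * inertia S i else 0) (\<lambda>i. - k * droop S i) \<omega> us)"
proof -
  have fin: "finite (controllers S)"
    using assms(1) unfolding well_formed_def buses_def freq_buses_def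
    by (meson finite_Un finite_subset)
  note deriv = piac_control_signal_derivative[OF assms(1,5,6)]
  have estimate: "converges_exponentially T k us (- power_imbalance S)"
    using deriv by (intro linear_relaxation_converges_exponentially[OF assms(4,3)])
      (simp add: add.commute)
  note steady = synchronous_state_optimal[OF assms]
  note pi_form = piac_proportional_integral[OF assms(1,4,6)]
  show ?thesis
    by (intro conjI allI ballI impI deriv estimate piac_unique_optimal_dispatch[OF fin assms(2,6)]
        sync_frequency_eq_0_iff_balanced[OF assms(1)] steady[THEN conjunct2]
        steady[THEN conjunct1, rule_format] pi_form[THEN conjunct2]
        pi_form[THEN conjunct1, rule_format])
qed

end
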